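(* Let $n$ be a positive integer and let $V:\mathcal S_0^n\to\mathbb R$ be a radial continuous valuation on the $n$-dimensional star bodies such that $V(\{0\})=0$. Then there exist two radial continuous valuations $V^+,V^-:\mathcal S_0^n\to\mathbb R_+=[0,\infty)$ such that $V^+(\{0\})=V^-(\{0\})=0$ and $$V=V^+-V^-.$$ Moreover, if $V$ is rotationally invariant, so are $V^+$ and $V^-$ (that is, they can be chosen rotationally invariant).
   Context: A set $L\subset\mathbb R^n$ is a star set if it contains the origin and every line through $0$ that meets $L$ does so in a (possibly degenerate) line segment. Its radial function is $\rho_L(t)=\sup\{c\ge 0: ct\in L\}$, $t\in S^{n-1}$. $L$ is a star body if $\rho_L$ is continuous on $S^{n-1}$; $\mathcal S_0^n$ is the set of star bodies of $\mathbb R^n$, which are identified with their radial functions (the nonnegative continuous functions on $S^{n-1}$). "Radial continuous" means continuous for the radial metric $\delta(K,L)=\|\rho_K-\rho_L\|_\infty$. $V$ is a valuation if $V(K\cup L)+V(K\cap L)=V(K)+V(L)$ for all $K,L\in\mathcal S_0^n$. $V$ is rotationally invariant if $V(\Phi(L))=V(L)$ for every $L\in\mathcal S_0^n$ and every rotation $\Phi$ of $\mathbb R^n$. *)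

theory Defs
  imports "HOL-Analysis.Analysis"
begin

text \<open>Segments are closed.  Hence the ray in direction \<open>t\<close> meets a star set \<open>L\<close> exactly in the points
  \<open>c *\<^sub>R t\<close> with \<open>0 \<le> c \<le> radial_function L t\<close>: a star set is bounded in every direction and is
  determined by its radial function, which is the usual identification of the two.\<close>

definition star_set :: "(real ^ 'n) set \<Rightarrow> bool" where
  "star_set L \<longleftrightarrow> 0 \<in> L \<and>
     (\<forall>u. u \<noteq> 0 \<longrightarrow> L \<inter> span {u} \<noteq> {} \<longrightarrow> (\<exists>a b. L \<inter> span {u} = closed_segment a b))"

definition radial_function :: "(real ^ 'n) set \<Rightarrow> real ^ 'n \<Rightarrow> real" where
  "radial_function L t = Sup {c. 0 \<le> c \<and> c *\<^sub>R t \<in> L}"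

definition star_bodies :: "(real ^ 'n) set set" where
  "star_bodies = {L. star_set L \<and> continuous_on (sphere 0 1) (radial_function L)}"

definition radial_dist :: "(real ^ 'n) set \<Rightarrow> (real ^ 'n) set \<Rightarrow> real" where
  "radial_dist K L = (SUP t\<in>sphere 0 1. \<bar>radial_function K t - radial_function L t\<bar>)"

text \<open>Functionals on star bodies are total functions on sets; only their values on
  \<open>star_bodies\<close> are relevant.\<close>

definition radial_continuous :: "((real ^ 'n) set \<Rightarrow> real) \<Rightarrow> bool" where
  "radial_continuous V \<longleftrightarrow>
     (\<forall>K\<in>star_bodies. \<forall>e>0. \<exists>d>0. \<forall>L\<in>star_bodies. radial_dist K L < d \<longrightarrow> \<bar>V L - V K\<bar> < e)"

definition valuation :: "((real ^ 'n) set \<Rightarrow> real) \<Rightarrow> bool" where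
  "valuation V \<longleftrightarrow>
     (\<forall>K\<in>star_bodies. \<forall>L\<in>star_bodies. V (K \<union> L) + V (K \<inter> L) = V K + V L)"

definition rotation_invariant :: "((real ^ 'n) set \<Rightarrow> real) \<Rightarrow> bool" where
  "rotation_invariant V \<longleftrightarrow>
     (\<forall>Q. rotation_matrix Q \<longrightarrow> (\<forall>L\<in>star_bodies. V ((\<lambda>x. Q *v x) ` L) = V L))"

end

theory Submission
  imports Defs
begin

text \<open>A valuation on star bodies is a functional \<open>W\<close> on the lattice of nonnegative continuous functions on
  the sphere, and \<open>V\<^sup>+\<close> is the monotone hull \<open>f \<mapsto> sup {W g | 0 \<le> g \<le> f}\<close>. The supremum is finite because
  the bound on \<open>{f. f \<le> c}\<close> propagates past every constant \<open>c\<close> by continuity at \<open>c\<close> and modularity.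
  Superadditivity of \<open>V\<^sup>+\<close> on \<open>max\<close> and \<open>min\<close> is immediate. For the converse, \<open>k \<le> h\<close> with
  \<open>h \<le> max f g\<close> and \<open>k \<le> min f g\<close> must be redistributed as \<open>u \<le> f\<close> and \<open>v \<le> g\<close>, switching between
  \<open>h\<close> and \<open>k\<close> across \<open>{f = g}\<close>. The switch is made continuous on a strip around \<open>{f = g + s}\<close>,
  where the small shift \<open>s\<close> is chosen so that \<open>W\<close> is negligible on functions supported in that strip.\<close>

section \<open>The monotone hull of a continuous valuation\<close>

text \<open>Functions are total, but membership constrains them on \<open>S\<close> only; values
  elsewhere are arbitrary.\<close>

definition nonneg_continuous :: "'a::topological_space set \<Rightarrow> ('a \<Rightarrow> real) set" where
  "nonneg_continuous S = {f. continuous_on S f \<and> (\<forall>x\<in>S. 0 \<le> f x)}"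

definition positive_part :: "'a::topological_space set \<Rightarrow> (('a \<Rightarrow> real) \<Rightarrow> real) \<Rightarrow> ('a \<Rightarrow> real) \<Rightarrow> real" where
  "positive_part S W f = Sup (W ` {g \<in> nonneg_continuous S. \<forall>x\<in>S. g x \<le> f x})"

lemma nonneg_continuous_intros:
  "0 \<le> c \<Longrightarrow> (\<lambda>_. c) \<in> nonneg_continuous S"
  "f \<in> nonneg_continuous S \<Longrightarrow> g \<in> nonneg_continuous S \<Longrightarrow> (\<lambda>x. max (f x) (g x)) \<in> nonneg_continuous S"
  "f \<in> nonneg_continuous S \<Longrightarrow> g \<in> nonneg_continuous S \<Longrightarrow> (\<lambda>x. min (f x) (g x)) \<in> nonneg_continuous S"
  "f \<in> nonneg_continuous S \<Longrightarrow> g \<in> nonneg_continuous S \<Longrightarrow> (\<lambda>x. f x + g x) \<in> nonneg_continuous S"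
  by (auto simp: nonneg_continuous_def le_max_iff_disj intro!: continuous_intros)

lemma positive_part_cong:
  "(\<And>x. x \<in> S \<Longrightarrow> f x = g x) \<Longrightarrow> positive_part S W f = positive_part S W g"
  unfolding positive_part_def by (intro arg_cong[of _ _ Sup] arg_cong[of _ _ "image W"]) auto

text \<open>Precomposition with \<open>T\<close> and \<open>T'\<close> carries the competitors below
  \<open>f\<close> and those below \<open>f \<circ> T\<close> into each other without changing
  \<open>W\<close>, so both suprema range over the same set of values.\<close>

lemma positive_part_compose:
  assumes T: "continuous_on S T" "T ` S \<subseteq> S" and T': "continuous_on S T'" "T' ` S \<subseteq> S"
    and inverse: "\<And>x. x \<in> S \<Longrightarrow> T (T' x) = x" "\<And>x. x \<in> S \<Longrightarrow> T' (T x) = x"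
    and W: "\<And>g. g \<in> nonneg_continuous S \<Longrightarrow> W (\<lambda>x. g (T x)) = W g"
    and W': "\<And>g. g \<in> nonneg_continuous S \<Longrightarrow> W (\<lambda>x. g (T' x)) = W g"
  shows "positive_part S W (\<lambda>x. f (T x)) = positive_part S W f"
proof -
  have comp: "(\<lambda>x. g (R x)) \<in> nonneg_continuous S"
    if "g \<in> nonneg_continuous S" "continuous_on S R" "R ` S \<subseteq> S" for g R
    using that continuous_on_compose2[of S g S R] by (auto simp: nonneg_continuous_def)
  have "W ` {g \<in> nonneg_continuous S. \<forall>x\<in>S. g x \<le> f (T x)}
      = W ` {g \<in> nonneg_continuous S. \<forall>x\<in>S. g x \<le> f x}" (is "W ` ?A = W ` ?B")
  proof (intro equalityI subsetI)
    fix w assume "w \<in> W ` ?A"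
    then obtain g where g: "g \<in> ?A" "w = W g" by blast
    have "g (T' x) \<le> f x" if "x \<in> S" for x
      using g(1) T'(2) inverse(1)[OF that] that by (metis (mono_tags, lifting) image_subset_iff mem_Collect_eq)
    then have "(\<lambda>x. g (T' x)) \<in> ?B"
      using comp[of g T'] T' g(1) by blast
    moreover have "w = W (\<lambda>x. g (T' x))" using W' g by auto
    ultimately show "w \<in> W ` ?B" by blast
  next
    fix w assume "w \<in> W ` ?B"
    then obtain g where g: "g \<in> ?B" "w = W g" by blast
    then have "(\<lambda>x. g (T x)) \<in> ?A"
      using comp[of g T] T by blast
    moreover have "w = W (\<lambda>x. g (T x))" using W g by auto
    ultimately show "w \<in> W ` ?A" by blast
  qed
  then show ?thesis by (simp add: positive_part_def)
qed

locale continuous_valuation =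
  fixes S :: "'a::topological_space set" and W :: "('a \<Rightarrow> real) \<Rightarrow> real"
  assumes compact: "compact S"
    and continuous: "f \<in> nonneg_continuous S \<Longrightarrow> 0 < e \<Longrightarrow>
      \<exists>d>0. \<forall>g\<in>nonneg_continuous S. (\<forall>x\<in>S. \<bar>g x - f x\<bar> < d) \<longrightarrow> \<bar>W g - W f\<bar> < e"
    and modular: "f \<in> nonneg_continuous S \<Longrightarrow> g \<in> nonneg_continuous S \<Longrightarrow>
      W (\<lambda>x. max (f x) (g x)) + W (\<lambda>x. min (f x) (g x)) = W f + W g"
    and zero: "W (\<lambda>_. 0) = 0"
begin

section \<open>Boundedness of the valuation on bounded functions\<close>

text \<open>At uniform distance zero on \<open>S\<close>, continuity leaves no room for a gap; the
  alleged gap itself serves as \<open>e\<close>.\<close>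

lemma cong:
  assumes "f \<in> nonneg_continuous S" "g \<in> nonneg_continuous S" "\<And>x. x \<in> S \<Longrightarrow> f x = g x"
  shows "W f = W g"
proof (rule ccontr)
  assume "W f \<noteq> W g"
  then have "0 < \<bar>W g - W f\<bar>" by simp
  from continuous[OF assms(1) this] assms(2,3) show False by force
qed

lemma bounded_on_bounded:
  "\<exists>B. \<forall>f\<in>nonneg_continuous S. (\<forall>x\<in>S. f x \<le> M) \<longrightarrow> \<bar>W f\<bar> \<le> B"
proof -
  define P where "P c \<longleftrightarrow> (\<exists>B. \<forall>f\<in>nonneg_continuous S. (\<forall>x\<in>S. f x \<le> c) \<longrightarrow> \<bar>W f\<bar> \<le> B)" for c
  have P_mono: "P c'" if "P c" "c' \<le> c" for c c'
    using that unfolding P_def by (meson order_trans)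
  define A where "A = {c. 0 \<le> c \<and> P c}"
  have "\<bar>W f\<bar> \<le> 0" if "f \<in> nonneg_continuous S" "\<forall>x\<in>S. f x \<le> 0" for f
  proof -
    have "W f = W (\<lambda>_. 0)"
      using that by (intro cong nonneg_continuous_intros) (auto simp: nonneg_continuous_def intro: antisym)
    then show ?thesis using zero by simp
  qed
  then have "0 \<in> A" by (auto simp: A_def P_def)
  have "\<not> bdd_above A"
  proof
    assume bdd: "bdd_above A"
    define s where "s = Sup A"
    have "0 \<le> s" using \<open>0 \<in> A\<close> bdd by (auto simp: s_def intro: cSup_upper)
    obtain d where d: "d > 0"
      "\<And>g. g \<in> nonneg_continuous S \<Longrightarrow> (\<forall>x\<in>S. \<bar>g x - s\<bar> < d) \<Longrightarrow> \<bar>W g - W (\<lambda>_. s)\<bar> < 1"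
      using continuous[OF nonneg_continuous_intros(1)[OF \<open>0 \<le> s\<close>], of 1] by auto
    obtain c where c: "c \<in> A" "s - d < c"
      using less_cSupD[of A "s - d"] \<open>0 \<in> A\<close> d(1) by (auto simp: s_def)
    then obtain B where B: "\<And>f. f \<in> nonneg_continuous S \<Longrightarrow> (\<forall>x\<in>S. f x \<le> c) \<Longrightarrow> \<bar>W f\<bar> \<le> B"
      by (auto simp: A_def P_def)
    have "c \<le> s" using c(1) bdd by (auto simp: s_def intro: cSup_upper)
    have C: "(\<lambda>_. c) \<in> nonneg_continuous S"
      using c(1) by (intro nonneg_continuous_intros) (auto simp: A_def)
    \<comment> \<open>Modularity against the constant \<open>c\<close> expresses \<open>W f\<close>
      through \<open>max f c\<close>, \<open>min f c\<close> and \<open>c\<close>. The first lies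
      within \<open>d\<close> of \<open>s\<close>, because s - d < c \<le> max f c \<le> s + d / 2;
      the second stays below the level \<open>c\<close>, where \<open>B\<close> applies.\<close>
    have "\<bar>W f\<bar> \<le> \<bar>W (\<lambda>_. s)\<bar> + 1 + B + \<bar>W (\<lambda>_. c)\<bar>"
      if f: "f \<in> nonneg_continuous S" "\<forall>x\<in>S. f x \<le> s + d / 2" for f
    proof -
      have "\<bar>W (\<lambda>x. max (f x) c) - W (\<lambda>_. s)\<bar> < 1"
      proof (rule d(2))
        show "\<forall>x\<in>S. \<bar>max (f x) c - s\<bar> < d"
        proof
          fix x assume "x \<in> S"
          with f(2) have "f x \<le> s + d / 2" by blast
          with c(2) \<open>c \<le> s\<close> d(1) show "\<bar>max (f x) c - s\<bar> < d" by (auto simp: max_def abs_less_iff)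
        qed
      qed (intro nonneg_continuous_intros f C)
      moreover have "\<bar>W (\<lambda>x. min (f x) c)\<bar> \<le> B"
        by (intro B nonneg_continuous_intros f C) auto
      ultimately show ?thesis using modular[OF f(1) C] by linarith
    qed
    then have "P (s + d / 2)" by (auto simp: P_def)
    then have "s + d / 2 \<in> A" using \<open>0 \<le> s\<close> d(1) by (simp add: A_def)
    then have "s + d / 2 \<le> s" unfolding s_def using bdd by (rule cSup_upper)
    then show False using d(1) by simp
  qed
  then obtain c where "c \<in> A" "M \<le> c" unfolding bdd_above_def by (meson linear)
  then have "P M" using P_mono by (auto simp: A_def)
  then show ?thesis by (simp only: P_def)
qed

lemma nonneg_continuous_bounded:
  assumes "f \<in> nonneg_continuous S"
  obtains M where "0 \<le> M" "\<And>x. x \<in> S \<Longrightarrow> f x \<le> M"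
proof -
  have "bounded (f ` S)"
    using assms compact by (auto simp: nonneg_continuous_def intro!: compact_imp_bounded compact_continuous_image)
  then obtain M where "\<forall>x\<in>S. \<bar>f x\<bar> \<le> M" by (auto simp: bounded_iff)
  then show thesis by (intro that[of "max M 0"]) fastforce+
qed

section \<open>Finiteness, sign and continuity of the hull\<close>

text \<open>The supremum is finite: \<open>f\<close> is bounded on the compact set \<open>S\<close>,
  and this bounds \<open>W\<close> on all competitors at once.\<close>

lemma positive_part_upper:
  assumes "f \<in> nonneg_continuous S" "g \<in> nonneg_continuous S" "\<And>x. x \<in> S \<Longrightarrow> g x \<le> f x"
  shows "W g \<le> positive_part S W f"
proof -
  obtain M where M: "\<And>x. x \<in> S \<Longrightarrow> f x \<le> M"
    using nonneg_continuous_bounded[OF assms(1)] by metis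
  obtain B where B: "\<forall>h\<in>nonneg_continuous S. (\<forall>x\<in>S. h x \<le> M) \<longrightarrow> \<bar>W h\<bar> \<le> B"
    using bounded_on_bounded by blast
  have "bdd_above (W ` {g \<in> nonneg_continuous S. \<forall>x\<in>S. g x \<le> f x})"
  proof (rule bdd_aboveI2)
    fix h assume "h \<in> {g \<in> nonneg_continuous S. \<forall>x\<in>S. g x \<le> f x}"
    with B M have "\<bar>W h\<bar> \<le> B" by (blast intro: order_trans)
    then show "W h \<le> B" by simp
  qed
  then show ?thesis unfolding positive_part_def using assms by (intro cSup_upper) auto
qed

text \<open>The supremum is over a nonempty set, since \<open>f\<close> competes with
  itself.\<close>

lemma positive_part_least:
  assumes "f \<in> nonneg_continuous S"
    and "\<And>g. g \<in> nonneg_continuous S \<Longrightarrow> (\<And>x. x \<in> S \<Longrightarrow> g x \<le> f x) \<Longrightarrow> W g \<le> z"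
  shows "positive_part S W f \<le> z"
  unfolding positive_part_def using assms by (intro cSup_least) auto

lemma positive_part_zero: "positive_part S W (\<lambda>_. 0) = 0"
proof (rule antisym)
  have C: "(\<lambda>_. 0) \<in> nonneg_continuous S" by (intro nonneg_continuous_intros) simp
  show "0 \<le> positive_part S W (\<lambda>_. 0)" using positive_part_upper[OF C C] zero by simp
  show "positive_part S W (\<lambda>_. 0) \<le> 0"
  proof (rule positive_part_least[OF C])
    fix g assume g: "g \<in> nonneg_continuous S" "\<And>x. x \<in> S \<Longrightarrow> g x \<le> 0"
    have "W g = W (\<lambda>_. 0)"
      using g by (intro cong C) (auto simp: nonneg_continuous_def intro: antisym)
    then show "W g \<le> 0" using zero by simp
  qed
qed

lemma positive_part_nonneg:
  assumes "f \<in> nonneg_continuous S"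
  shows "0 \<le> positive_part S W f"
proof -
  have "W (\<lambda>_. 0) \<le> positive_part S W f"
    using assms by (intro positive_part_upper nonneg_continuous_intros) (auto simp: nonneg_continuous_def)
  then show ?thesis using zero by simp
qed

text \<open>For the upper estimate, a competitor \<open>h \<le> g\<close> is cut off at \<open>f\<close>: by modularity the error is
  \<open>W (max h f) - W f\<close>, and \<open>max h f\<close> is uniformly close to \<open>f\<close>. Hence continuity of \<open>W\<close> at the
  single point \<open>f\<close> suffices.\<close>

lemma positive_part_continuous:
  assumes f: "f \<in> nonneg_continuous S" and "0 < e"
  shows "\<exists>d>0. \<forall>g\<in>nonneg_continuous S. (\<forall>x\<in>S. \<bar>g x - f x\<bar> < d) \<longrightarrow>
    \<bar>positive_part S W g - positive_part S W f\<bar> < e"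
proof -
  obtain d1 where d1: "d1 > 0"
    "\<And>g. g \<in> nonneg_continuous S \<Longrightarrow> (\<forall>x\<in>S. \<bar>g x - f x\<bar> < d1) \<Longrightarrow> \<bar>W g - W f\<bar> < e / 2"
    using continuous[OF f, of "e / 2"] \<open>0 < e\<close> by auto
  \<comment> \<open>For the lower estimate, a nearly optimal competitor \<open>k\<close> of
    \<open>f\<close> is fixed before \<open>g\<close>, so that continuity at \<open>k\<close> can
    supply \<open>d2\<close>. Then \<open>min k g\<close> competes for \<open>g\<close> and is close
    to \<open>k\<close>.\<close>
  have "\<exists>w \<in> W ` {g \<in> nonneg_continuous S. \<forall>x\<in>S. g x \<le> f x}. positive_part S W f - e / 4 < w"
    unfolding positive_part_def using f \<open>0 < e\<close> by (intro less_cSupD) auto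
  then obtain k where k: "k \<in> nonneg_continuous S" "\<And>x. x \<in> S \<Longrightarrow> k x \<le> f x"
    and k_large: "positive_part S W f - e / 4 < W k" by auto
  obtain d2 where d2: "d2 > 0"
    "\<And>g. g \<in> nonneg_continuous S \<Longrightarrow> (\<forall>x\<in>S. \<bar>g x - k x\<bar> < d2) \<Longrightarrow> \<bar>W g - W k\<bar> < e / 4"
    using continuous[OF k(1), of "e / 4"] \<open>0 < e\<close> by auto
  have "\<bar>positive_part S W g - positive_part S W f\<bar> < e"
    if g: "g \<in> nonneg_continuous S" and close: "\<forall>x\<in>S. \<bar>g x - f x\<bar> < min d1 d2" for g
  proof -
    have "\<bar>W (\<lambda>x. min (k x) (g x)) - W k\<bar> < e / 4"
    proof (rule d2(2))
      show "\<forall>x\<in>S. \<bar>min (k x) (g x) - k x\<bar> < d2"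
      proof
        fix x assume "x \<in> S"
        with close k(2) have "\<bar>g x - f x\<bar> < d2" "k x \<le> f x" by auto
        then show "\<bar>min (k x) (g x) - k x\<bar> < d2" using d2(1) by (auto simp: min_def)
      qed
    qed (intro nonneg_continuous_intros k g)
    moreover have "W (\<lambda>x. min (k x) (g x)) \<le> positive_part S W g"
      by (intro positive_part_upper nonneg_continuous_intros k g) auto
    moreover have "positive_part S W g \<le> positive_part S W f + e / 2"
    proof (rule positive_part_least[OF g])
      fix h assume h: "h \<in> nonneg_continuous S" "\<And>x. x \<in> S \<Longrightarrow> h x \<le> g x"
      have "\<bar>W (\<lambda>x. max (h x) (f x)) - W f\<bar> < e / 2"
      proof (rule d1(2))
        show "\<forall>x\<in>S. \<bar>max (h x) (f x) - f x\<bar> < d1"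
        proof
          fix x assume "x \<in> S"
          with close h(2) have "\<bar>g x - f x\<bar> < d1" "h x \<le> g x" by auto
          then show "\<bar>max (h x) (f x) - f x\<bar> < d1" using d1(1) by (auto simp: max_def)
        qed
      qed (intro nonneg_continuous_intros h f)
      moreover have "W (\<lambda>x. min (h x) (f x)) \<le> positive_part S W f"
        by (intro positive_part_upper nonneg_continuous_intros h f) auto
      ultimately show "W h \<le> positive_part S W f + e / 2"
        using modular[OF h(1) f] by linarith
    qed
    ultimately show ?thesis using k_large \<open>0 < e\<close> by linarith
  qed
  then show ?thesis using d1(1) d2(1) by (intro exI[of _ "min d1 d2"]) auto
qed

section \<open>Negligible strips, redistribution and modularity of the hull\<close>

text \<open>For disjoint supports the sum is the maximum and the minimum vanishes, so modularity
  becomes additivity. At most one summand is nonzero at each point, hence the bound \<open>M\<close>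
  does not grow with the number of summands.\<close>

lemma disjoint_sum:
  assumes "finite J" and "\<And>i. i \<in> J \<Longrightarrow> \<phi> i \<in> nonneg_continuous S"
    and "\<And>i x. i \<in> J \<Longrightarrow> x \<in> S \<Longrightarrow> \<phi> i x \<le> M" and "0 \<le> M"
    and "\<And>i j x. i \<in> J \<Longrightarrow> j \<in> J \<Longrightarrow> i \<noteq> j \<Longrightarrow> x \<in> S \<Longrightarrow> \<phi> i x = 0 \<or> \<phi> j x = 0"
  shows "(\<lambda>x. \<Sum>i\<in>J. \<phi> i x) \<in> nonneg_continuous S \<and> (\<forall>x\<in>S. (\<Sum>i\<in>J. \<phi> i x) \<le> M) \<and>
    W (\<lambda>x. \<Sum>i\<in>J. \<phi> i x) = (\<Sum>i\<in>J. W (\<phi> i))"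
  using assms
proof (induction J rule: finite_induct)
  case empty
  then show ?case using zero by (auto intro: nonneg_continuous_intros)
next
  case (insert j J)
  let ?s = "\<lambda>x. \<Sum>i\<in>J. \<phi> i x"
  have IH: "?s \<in> nonneg_continuous S" "\<forall>x\<in>S. ?s x \<le> M" "W ?s = (\<Sum>i\<in>J. W (\<phi> i))"
    using insert.IH insert.prems by auto
  have \<phi>: "\<phi> j \<in> nonneg_continuous S" using insert.prems by auto
  have disj: "\<phi> j x = 0 \<or> ?s x = 0" if "x \<in> S" for x
  proof (cases "\<phi> j x = 0")
    case False
    then have "\<phi> i x = 0" if "i \<in> J" for i
      using insert.prems(4)[of j i x] insert.hyps that \<open>x \<in> S\<close> by auto
    then show ?thesis by simp
  qed simp
  have pos: "0 \<le> \<phi> j x" "0 \<le> ?s x" if "x \<in> S" for x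
    using \<phi> IH(1) that by (auto simp: nonneg_continuous_def)
  have C: "(\<lambda>x. \<phi> j x + ?s x) \<in> nonneg_continuous S"
    by (intro nonneg_continuous_intros \<phi> IH)
  have "W (\<lambda>x. max (\<phi> j x) (?s x)) = W (\<lambda>x. \<phi> j x + ?s x)"
    using disj pos by (intro cong C nonneg_continuous_intros \<phi> IH) fastforce
  moreover have "W (\<lambda>x. min (\<phi> j x) (?s x)) = W (\<lambda>_. 0)"
    using disj pos by (intro cong nonneg_continuous_intros \<phi> IH) fastforce+
  ultimately have "W (\<lambda>x. \<phi> j x + ?s x) = W (\<phi> j) + W ?s"
    using modular[OF \<phi> IH(1)] zero by simp
  moreover have "\<phi> j x + ?s x \<le> M" if "x \<in> S" for x
    using disj[OF that] IH(2) insert.prems(2)[of j x] that by auto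
  ultimately show ?case using insert.hyps IH(3) C by simp
qed

text \<open>Many disjoint level strips of \<open>p\<close> cannot all carry a large value of \<open>W\<close>, since the sums of the
  corresponding functions stay bounded.\<close>

lemma exists_negligible_strip:
  fixes p :: "'a \<Rightarrow> real"
  assumes "0 < e" "0 < c" "0 \<le> M"
  obtains s \<delta> where "0 < s" "s < c" "0 < \<delta>"
    "\<And>\<phi>. \<phi> \<in> nonneg_continuous S \<Longrightarrow> (\<And>x. x \<in> S \<Longrightarrow> \<phi> x \<le> M) \<Longrightarrow>
      (\<And>x. x \<in> S \<Longrightarrow> \<delta> \<le> \<bar>p x - s\<bar> \<Longrightarrow> \<phi> x = 0) \<Longrightarrow> \<bar>W \<phi>\<bar> \<le> e"
proof -
  obtain B where B: "\<forall>f\<in>nonneg_continuous S. (\<forall>x\<in>S. f x \<le> M) \<longrightarrow> \<bar>W f\<bar> \<le> B"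
    using bounded_on_bounded by blast
  \<comment> \<open>\<open>N\<close> strips that each carry a value above \<open>e\<close> would
    exceed the total \<open>2 * B\<close> that the two signs together allow.\<close>
  obtain N where N: "2 * B < real N * e" using \<open>0 < e\<close> reals_Archimedean3 by blast
  \<comment> \<open>The centres \<open>s i\<close> are spaced by \<open>2 * \<delta>\<close>, so the
    open strips of half-width \<open>\<delta>\<close> are disjoint. The shift by 1 in
    \<open>s i\<close> keeps the centres positive, and \<open>c = 2 * \<delta> * (N + 1)\<close>
    keeps the last one, \<open>2 * \<delta> * N\<close>, below \<open>c\<close>.\<close>
  define \<delta> where "\<delta> = c / (real N + 1) / 2"
  define s where "s i = 2 * \<delta> * (real i + 1)" for i
  have s_bounds: "0 < s i" "s i < c" if "i < N" for i
    using that \<open>0 < c\<close> by (auto simp: s_def \<delta>_def divide_simps intro!: mult_pos_pos add_nonneg_pos)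
  have "0 < \<delta>" using \<open>0 < c\<close> by (simp add: \<delta>_def)
  have s_diff: "2 * \<delta> \<le> \<bar>s i - s j\<bar>" if "i \<noteq> j" for i j
  proof -
    have "s i - s j = 2 * \<delta> * (real i - real j)" by (simp add: s_def algebra_simps)
    moreover have "1 \<le> \<bar>real i - real j\<bar>" using that by linarith
    ultimately show ?thesis using \<open>0 < \<delta>\<close> by (simp add: abs_mult)
  qed
  have "\<exists>i<N. \<forall>\<phi>\<in>nonneg_continuous S. (\<forall>x\<in>S. \<phi> x \<le> M) \<longrightarrow>
      (\<forall>x\<in>S. \<delta> \<le> \<bar>p x - s i\<bar> \<longrightarrow> \<phi> x = 0) \<longrightarrow> \<bar>W \<phi>\<bar> \<le> e"
  proof (rule ccontr)
    assume "\<not> ?thesis"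
    then have "\<forall>i\<in>{..<N}. \<exists>\<phi>. \<phi> \<in> nonneg_continuous S \<and> (\<forall>x\<in>S. \<phi> x \<le> M) \<and>
      (\<forall>x\<in>S. \<delta> \<le> \<bar>p x - s i\<bar> \<longrightarrow> \<phi> x = 0) \<and> e < \<bar>W \<phi>\<bar>"
      by (auto simp: not_le)
    then obtain \<phi> where \<phi>: "\<forall>i\<in>{..<N}. \<phi> i \<in> nonneg_continuous S \<and> (\<forall>x\<in>S. \<phi> i x \<le> M) \<and>
      (\<forall>x\<in>S. \<delta> \<le> \<bar>p x - s i\<bar> \<longrightarrow> \<phi> i x = 0) \<and> e < \<bar>W (\<phi> i)\<bar>"
      by (rule bchoice[THEN exE])
    have disj: "\<phi> i x = 0 \<or> \<phi> j x = 0" if "i < N" "j < N" "i \<noteq> j" "x \<in> S" for i j x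
    proof (rule ccontr)
      assume "\<not> ?thesis"
      then have "\<bar>p x - s i\<bar> < \<delta>" "\<bar>p x - s j\<bar> < \<delta>" using \<phi> that by (meson lessThan_iff not_le)+
      then show False using s_diff[OF \<open>i \<noteq> j\<close>] by linarith
    qed
    have sum_le: "\<bar>\<Sum>i\<in>J. W (\<phi> i)\<bar> \<le> B" if "J \<subseteq> {..<N}" for J
    proof -
      have "(\<lambda>x. \<Sum>i\<in>J. \<phi> i x) \<in> nonneg_continuous S \<and> (\<forall>x\<in>S. (\<Sum>i\<in>J. \<phi> i x) \<le> M) \<and>
        W (\<lambda>x. \<Sum>i\<in>J. \<phi> i x) = (\<Sum>i\<in>J. W (\<phi> i))"
      proof (rule disjoint_sum)
        show "finite J" using that by (rule finite_subset) simp
        show "\<phi> i \<in> nonneg_continuous S" "x \<in> S \<Longrightarrow> \<phi> i x \<le> M" if "i \<in> J" for i x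
          using \<phi> \<open>i \<in> J\<close> \<open>J \<subseteq> {..<N}\<close> by auto
        show "\<phi> i x = 0 \<or> \<phi> j x = 0" if "i \<in> J" "j \<in> J" "i \<noteq> j" "x \<in> S" for i j x
          using disj[of i j x] that \<open>J \<subseteq> {..<N}\<close> by auto
      qed (rule \<open>0 \<le> M\<close>)
      then show ?thesis using B by metis
    qed
    \<comment> \<open>In a sum of values of \<open>W\<close> opposite signs may cancel, so the bound
      \<open>B\<close> is applied to the indices of each sign separately.\<close>
    let ?P = "{i. i < N \<and> 0 \<le> W (\<phi> i)}" and ?Q = "{i. i < N \<and> W (\<phi> i) < 0}"
    have "real N * e = (\<Sum>i<N. e)" by simp
    also have "\<dots> \<le> (\<Sum>i<N. \<bar>W (\<phi> i)\<bar>)" using \<phi> by (intro sum_mono) force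
    also have "\<dots> = (\<Sum>i\<in>?P \<union> ?Q. \<bar>W (\<phi> i)\<bar>)" by (intro sum.cong) auto
    also have "\<dots> = (\<Sum>i\<in>?P. \<bar>W (\<phi> i)\<bar>) + (\<Sum>i\<in>?Q. \<bar>W (\<phi> i)\<bar>)"
      by (intro sum.union_disjoint) auto
    also have "\<dots> = (\<Sum>i\<in>?P. W (\<phi> i)) - (\<Sum>i\<in>?Q. W (\<phi> i))"
      by (simp flip: sum_negf)
    also have "\<dots> \<le> 2 * B" using sum_le[of ?P] sum_le[of ?Q] by fastforce
    finally show False using N by simp
  qed
  then obtain i where "i < N" "\<And>\<phi>. \<phi> \<in> nonneg_continuous S \<Longrightarrow> (\<And>x. x \<in> S \<Longrightarrow> \<phi> x \<le> M) \<Longrightarrow>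
      (\<And>x. x \<in> S \<Longrightarrow> \<delta> \<le> \<bar>p x - s i\<bar> \<Longrightarrow> \<phi> x = 0) \<Longrightarrow> \<bar>W \<phi>\<bar> \<le> e"
    by auto
  then show thesis using that[of "s i" \<delta>] s_bounds \<open>0 < \<delta>\<close> by auto
qed

text \<open>The functions \<open>u\<close> and \<open>v\<close> follow \<open>h\<close> where \<open>g\<close> lies well below, respectively well above, \<open>f\<close>
  and drop to \<open>k\<close> elsewhere. Then \<open>max u v\<close> differs from \<open>h\<close> only on the strip \<open>\<bar>f - g\<bar> < \<delta>\<close>, and the
  resulting error lives on functions supported in the strip \<open>\<bar>f - g\<bar> < 2 * \<delta>\<close>.\<close>

lemma split_along_strip:
  assumes f: "f \<in> nonneg_continuous S" and g: "g \<in> nonneg_continuous S"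
    and h: "h \<in> nonneg_continuous S" "\<And>x. x \<in> S \<Longrightarrow> h x \<le> max (f x) (g x)"
    and k: "k \<in> nonneg_continuous S" "\<And>x. x \<in> S \<Longrightarrow> k x \<le> min (f x) (g x)"
    and kh: "\<And>x. x \<in> S \<Longrightarrow> k x \<le> h x" and hM: "\<And>x. x \<in> S \<Longrightarrow> h x \<le> M" and "0 \<le> M"
    and "0 < \<delta>"
    and strip: "\<And>\<phi>. \<phi> \<in> nonneg_continuous S \<Longrightarrow> (\<And>x. x \<in> S \<Longrightarrow> \<phi> x \<le> M) \<Longrightarrow>
      (\<And>x. x \<in> S \<Longrightarrow> 2 * \<delta> \<le> \<bar>f x - g x\<bar> \<Longrightarrow> \<phi> x = 0) \<Longrightarrow> \<bar>W \<phi>\<bar> \<le> e"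
  shows "W h + W k \<le> positive_part S W f + positive_part S W g + 2 * e"
proof -
  \<comment> \<open>The ramp has slope \<open>M / \<delta>\<close>: once \<open>f - g\<close>
    reaches \<open>\<delta>\<close> it has risen by at least \<open>M\<close>, which dominates
    \<open>h\<close>, and the minimum is then \<open>h\<close>.\<close>
  define u where "u x = min (k x + M * max 0 (f x - g x) / \<delta>) (h x)" for x
  define v where "v x = min (k x + M * max 0 (g x - f x) / \<delta>) (h x)" for x
  define w where "w x = max (u x) (v x)" for x
  \<comment> \<open>A cutoff of height \<open>M\<close> for \<bar>f - g\<bar> \<le> \<delta>,
    falling linearly to 0 at distance \<open>2 * \<delta>\<close>.\<close>
  define \<eta> where "\<eta> x = min M (M * max 0 (2 - \<bar>f x - g x\<bar> / \<delta>))" for x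
  have cont: "continuous_on S f" "continuous_on S g" "continuous_on S h" "continuous_on S k"
    and nonneg: "\<And>x. x \<in> S \<Longrightarrow> 0 \<le> f x \<and> 0 \<le> g x \<and> 0 \<le> h x \<and> 0 \<le> k x"
    using f g h k by (auto simp: nonneg_continuous_def)
  have u: "u \<in> nonneg_continuous S" and v: "v \<in> nonneg_continuous S" and \<eta>: "\<eta> \<in> nonneg_continuous S"
    using cont nonneg \<open>0 < \<delta>\<close> \<open>0 \<le> M\<close> unfolding nonneg_continuous_def u_def v_def \<eta>_def
    by (auto intro!: continuous_intros)
  have w: "w \<in> nonneg_continuous S" unfolding w_def by (intro nonneg_continuous_intros u v)
  have u_eq: "u x = k x" if "x \<in> S" "f x \<le> g x" for x
    using kh that by (simp add: u_def)
  have v_eq: "v x = k x" if "x \<in> S" "g x \<le> f x" for x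
    using kh that by (simp add: v_def)
  \<comment> \<open>Where f \<le> g, \<open>u\<close> equals \<open>k\<close>, which lies below
    \<open>f\<close>; elsewhere u \<le> h \<le> max f g = f.\<close>
  have uf: "u x \<le> f x" if "x \<in> S" for x
    using u_eq[OF that] h(2)[OF that] k(2)[OF that] by (cases "f x \<le> g x") (auto simp: u_def)
  have vg: "v x \<le> g x" if "x \<in> S" for x
    using v_eq[OF that] h(2)[OF that] k(2)[OF that] by (cases "g x \<le> f x") (auto simp: v_def)
  have ku: "k x \<le> u x" "k x \<le> v x" if "x \<in> S" for x
    using kh[OF that] \<open>0 < \<delta>\<close> \<open>0 \<le> M\<close> by (auto simp: u_def v_def)
  \<comment> \<open>At every point at least one of \<open>u\<close> and \<open>v\<close> has dropped
    to \<open>k\<close>, and neither goes below it.\<close>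
  have "W (\<lambda>x. min (u x) (v x)) = W k"
  proof (intro cong nonneg_continuous_intros u v k)
    fix x assume "x \<in> S"
    then show "min (u x) (v x) = k x" using u_eq v_eq ku by (cases "f x \<le> g x") auto
  qed
  then have uv: "W u + W v = W w + W k" using modular[OF u v] by (simp add: w_def[abs_def])
  have wh: "w x \<le> h x" for x by (simp add: w_def u_def v_def)
  have w_eq: "w x = h x" if "x \<in> S" "\<delta> \<le> \<bar>f x - g x\<bar>" for x
  proof -
    have *: "h x \<le> k x + M * max 0 t / \<delta>" if "\<delta> \<le> t" for t
    proof -
      have "M * \<delta> \<le> M * t" using that \<open>0 \<le> M\<close> by (rule mult_left_mono)
      then have "M \<le> M * max 0 t / \<delta>" using that \<open>0 < \<delta>\<close> by (simp add: field_simps)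
      then show ?thesis using hM[OF \<open>x \<in> S\<close>] nonneg[OF \<open>x \<in> S\<close>] by linarith
    qed
    have "\<delta> \<le> f x - g x \<or> \<delta> \<le> g x - f x" using that by linarith
    then have "u x = h x \<or> v x = h x"
      using *[of "f x - g x"] *[of "g x - f x"] by (auto simp: u_def v_def min_absorb2)
    then show ?thesis using wh[of x] by (auto simp: w_def u_def v_def)
  qed
  have \<eta>_eq: "\<eta> x = M" if "\<bar>f x - g x\<bar> < \<delta>" for x
  proof -
    have "1 \<le> max 0 (2 - \<bar>f x - g x\<bar> / \<delta>)" using that \<open>0 < \<delta>\<close> by (simp add: le_max_iff_disj field_simps)
    from mult_left_mono[OF this \<open>0 \<le> M\<close>] show ?thesis by (simp add: \<eta>_def)
  qed
  have \<eta>_zero: "\<eta> x = 0" if "2 * \<delta> \<le> \<bar>f x - g x\<bar>" for x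
    using that \<open>0 < \<delta>\<close> \<open>0 \<le> M\<close> by (simp add: \<eta>_def field_simps max_def)
  have small: "\<bar>W (\<lambda>x. min (r x) (\<eta> x))\<bar> \<le> e" if "r \<in> nonneg_continuous S" for r
  proof (rule strip)
    show "(\<lambda>x. min (r x) (\<eta> x)) \<in> nonneg_continuous S" by (intro nonneg_continuous_intros that \<eta>)
    show "min (r x) (\<eta> x) \<le> M" for x by (auto simp: \<eta>_def)
    show "min (r x) (\<eta> x) = 0" if "x \<in> S" "2 * \<delta> \<le> \<bar>f x - g x\<bar>" for x
      using \<eta>_zero \<open>r \<in> nonneg_continuous S\<close> that by (auto simp: nonneg_continuous_def)
  qed
  have h\<eta>: "(\<lambda>x. min (h x) (\<eta> x)) \<in> nonneg_continuous S" by (intro nonneg_continuous_intros h \<eta>)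
  \<comment> \<open>Modularity for \<open>min h \<eta>\<close> and \<open>w\<close> compares
    \<open>W h\<close> with \<open>W w\<close>. The maximum is \<open>h\<close>, since
    \<open>w = h\<close> off the strip and \<eta> = M \<ge> h on it; the minimum is
    \<open>min w \<eta>\<close>, since w \<le> h. Both error terms are supported in the wider strip,
    which gives \<open>2 * e\<close>.\<close>
  have "W (\<lambda>x. max (min (h x) (\<eta> x)) (w x)) = W h"
  proof (intro cong nonneg_continuous_intros h \<eta> w)
    fix x assume "x \<in> S"
    then show "max (min (h x) (\<eta> x)) (w x) = h x"
      using wh[of x] w_eq[of x] \<eta>_eq[of x] hM[of x] by (cases "\<bar>f x - g x\<bar> < \<delta>") auto
  qed
  moreover have "W (\<lambda>x. min (min (h x) (\<eta> x)) (w x)) = W (\<lambda>x. min (w x) (\<eta> x))"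
    using wh by (intro cong nonneg_continuous_intros h \<eta> w) (auto simp: min_def intro: antisym order_trans)
  ultimately have "W h + W (\<lambda>x. min (w x) (\<eta> x)) = W (\<lambda>x. min (h x) (\<eta> x)) + W w"
    using modular[OF h\<eta> w] by simp
  moreover have "W u \<le> positive_part S W f" "W v \<le> positive_part S W g"
    using positive_part_upper[OF f u uf] positive_part_upper[OF g v vg] by auto
  ultimately show ?thesis using uv small[OF h(1)] small[OF w] by linarith
qed

text \<open>The strip around {f = g} may be all of \<open>S\<close>, so \<open>g\<close> is first
  raised to \<open>g + s\<close>. Raising \<open>g\<close> preserves the constraints on
  \<open>h\<close> and \<open>k\<close>, and continuity of the hull at \<open>g\<close> absorbs the
  shift. The errors add up to \<open>2 * (e / 4) + e / 2\<close>.\<close>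

lemma positive_part_split_le:
  assumes f: "f \<in> nonneg_continuous S" and g: "g \<in> nonneg_continuous S"
    and h: "h \<in> nonneg_continuous S" "\<And>x. x \<in> S \<Longrightarrow> h x \<le> max (f x) (g x)"
    and k: "k \<in> nonneg_continuous S" "\<And>x. x \<in> S \<Longrightarrow> k x \<le> min (f x) (g x)"
    and kh: "\<And>x. x \<in> S \<Longrightarrow> k x \<le> h x"
  shows "W h + W k \<le> positive_part S W f + positive_part S W g"
proof (rule field_le_epsilon)
  fix e :: real assume "0 < e"
  obtain d where d: "d > 0" "\<And>g'. g' \<in> nonneg_continuous S \<Longrightarrow> (\<forall>x\<in>S. \<bar>g' x - g x\<bar> < d) \<Longrightarrow>
      \<bar>positive_part S W g' - positive_part S W g\<bar> < e / 2"
    using positive_part_continuous[OF g, of "e / 2"] \<open>0 < e\<close> by auto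
  obtain M where M: "0 \<le> M" "\<And>x. x \<in> S \<Longrightarrow> h x \<le> M"
    using nonneg_continuous_bounded[OF h(1)] by metis
  have "0 < e / 4" using \<open>0 < e\<close> by simp
  obtain s \<delta> where s: "0 < s" "s < d" "0 < \<delta>"
    and strip: "\<And>\<phi>. \<phi> \<in> nonneg_continuous S \<Longrightarrow> (\<And>x. x \<in> S \<Longrightarrow> \<phi> x \<le> M) \<Longrightarrow>
      (\<And>x. x \<in> S \<Longrightarrow> \<delta> \<le> \<bar>f x - g x - s\<bar> \<Longrightarrow> \<phi> x = 0) \<Longrightarrow> \<bar>W \<phi>\<bar> \<le> e / 4"
    using exists_negligible_strip[OF \<open>0 < e / 4\<close> d(1) M(1), of "\<lambda>x. f x - g x"] by metis
  let ?g = "\<lambda>x. g x + s"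
  have g': "?g \<in> nonneg_continuous S" using s by (intro nonneg_continuous_intros g) simp
  have "W h + W k \<le> positive_part S W f + positive_part S W ?g + 2 * (e / 4)"
  \<comment> \<open>The splitting allows supports up to twice its parameter, so the half-width
    \<open>\<delta>\<close> of the negligible strip is halved.\<close>
  proof (rule split_along_strip[OF f g' h(1) _ k(1) _ kh M(2) M(1), where \<delta> = "\<delta> / 2"])
    show "h x \<le> max (f x) (g x + s)" if "x \<in> S" for x using h(2)[OF that] s by auto
    show "k x \<le> min (f x) (g x + s)" if "x \<in> S" for x using k(2)[OF that] s by auto
    show "0 < \<delta> / 2" using s by simp
    fix \<phi> assume "\<phi> \<in> nonneg_continuous S" "\<And>x. x \<in> S \<Longrightarrow> \<phi> x \<le> M"
      "\<And>x. x \<in> S \<Longrightarrow> 2 * (\<delta> / 2) \<le> \<bar>f x - (g x + s)\<bar> \<Longrightarrow> \<phi> x = 0"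
    then show "\<bar>W \<phi>\<bar> \<le> e / 4" by (intro strip) (auto simp: algebra_simps)
  qed
  moreover have "\<bar>positive_part S W ?g - positive_part S W g\<bar> < e / 2"
    using s by (intro d(2) g') auto
  ultimately show "W h + W k \<le> positive_part S W f + positive_part S W g + e" by linarith
qed

lemma positive_part_modular:
  assumes f: "f \<in> nonneg_continuous S" and g: "g \<in> nonneg_continuous S"
  shows "positive_part S W (\<lambda>x. max (f x) (g x)) + positive_part S W (\<lambda>x. min (f x) (g x))
    = positive_part S W f + positive_part S W g" (is "?U + ?L = ?F + ?G")
proof (rule antisym)
  have max: "(\<lambda>x. max (f x) (g x)) \<in> nonneg_continuous S"
    and min: "(\<lambda>x. min (f x) (g x)) \<in> nonneg_continuous S"
    by (intro nonneg_continuous_intros f g)+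
  have le: "W h + W k \<le> ?F + ?G"
    if h: "h \<in> nonneg_continuous S" "\<And>x. x \<in> S \<Longrightarrow> h x \<le> max (f x) (g x)"
      and k: "k \<in> nonneg_continuous S" "\<And>x. x \<in> S \<Longrightarrow> k x \<le> min (f x) (g x)" for h k
  proof -
    \<comment> \<open>Replacing \<open>h\<close> and \<open>k\<close> by their maximum and minimum
      orders the pair. Both constraints survive, and modularity keeps the sum of values.\<close>
    have "W (\<lambda>x. max (h x) (k x)) + W (\<lambda>x. min (h x) (k x)) \<le> ?F + ?G"
      using h(2) k(2) by (intro positive_part_split_le f g nonneg_continuous_intros h(1) k(1)) fastforce+
    then show ?thesis using modular[OF h(1) k(1)] by simp
  qed
  \<comment> \<open>The suprema over \<open>k\<close> and \<open>h\<close> are taken one after the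
    other, with the remaining terms moved to the right-hand side.\<close>
  have "W h \<le> ?F + ?G - ?L"
    if h: "h \<in> nonneg_continuous S" "\<And>x. x \<in> S \<Longrightarrow> h x \<le> max (f x) (g x)" for h
  proof -
    have "W k \<le> ?F + ?G - W h"
      if "k \<in> nonneg_continuous S" "\<And>x. x \<in> S \<Longrightarrow> k x \<le> min (f x) (g x)" for k
      using le[OF h that] by simp
    then show ?thesis using positive_part_least[OF min, of "?F + ?G - W h"] by simp
  qed
  then show "?U + ?L \<le> ?F + ?G"
    using positive_part_least[OF max, of "?F + ?G - ?L"] by (simp add: algebra_simps)
  have ge: "W h + W k \<le> ?U + ?L"
    if h: "h \<in> nonneg_continuous S" "\<And>x. x \<in> S \<Longrightarrow> h x \<le> f x"
      and k: "k \<in> nonneg_continuous S" "\<And>x. x \<in> S \<Longrightarrow> k x \<le> g x" for h k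
  proof -
    have "W (\<lambda>x. max (h x) (k x)) \<le> ?U"
      using h(2) k(2) by (intro positive_part_upper max nonneg_continuous_intros h(1) k(1)) fastforce
    moreover have "W (\<lambda>x. min (h x) (k x)) \<le> ?L"
      using h(2) k(2) by (intro positive_part_upper min nonneg_continuous_intros h(1) k(1)) fastforce
    ultimately show ?thesis using modular[OF h(1) k(1)] by simp
  qed
  have "W h \<le> ?U + ?L - ?G"
    if h: "h \<in> nonneg_continuous S" "\<And>x. x \<in> S \<Longrightarrow> h x \<le> f x" for h
  proof -
    have "W k \<le> ?U + ?L - W h"
      if "k \<in> nonneg_continuous S" "\<And>x. x \<in> S \<Longrightarrow> k x \<le> g x" for k
      using ge[OF h that] by simp
    then show ?thesis using positive_part_least[OF g, of "?U + ?L - W h"] by simp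
  qed
  then show "?F + ?G \<le> ?U + ?L"
    using positive_part_least[OF f, of "?U + ?L - ?G"] by (simp add: algebra_simps)
qed

end

section \<open>Star bodies and their radial functions\<close>

text \<open>The inverse of the radial function. The origin has no direction and is added separately,
  so the value \<open>f 0\<close> is irrelevant.\<close>

definition star_body_of :: "(real ^ 'n \<Rightarrow> real) \<Rightarrow> (real ^ 'n) set" where
  "star_body_of f = {x. x = 0 \<or> norm x \<le> f (x /\<^sub>R norm x)}"

lemma scaleR_in_star_body_of_iff:
  assumes "f \<in> nonneg_continuous (sphere 0 1)" "norm t = 1" "0 \<le> c"
  shows "c *\<^sub>R t \<in> star_body_of f \<longleftrightarrow> c \<le> f t"
  using assms by (cases "c = 0") (auto simp: star_body_of_def nonneg_continuous_def)

lemma eq_scaleR_sphere: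
  fixes x :: "real ^ 'n"
  obtains c t where "norm t = 1" "0 \<le> c" "x = c *\<^sub>R t"
proof (cases "x = 0")
  case True
  obtain t :: "real ^ 'n" where "norm t = 1" using vector_choose_size[of 1] by auto
  with True that[of t 0] show thesis by simp
next
  case False
  with that[of "x /\<^sub>R norm x" "norm x"] show thesis by simp
qed

lemma closed_segment_scaleR:
  "closed_segment (a *\<^sub>R t) (b *\<^sub>R t) = (\<lambda>c. c *\<^sub>R t) ` closed_segment a b" for t :: "'a::real_vector"
  by (rule closed_segment_linear_image) (simp add: linear_iff algebra_simps)

text \<open>In the coordinate along \<open>t\<close>, the segment cut out by the line is a closed
  interval containing 0 whose endpoints \<open>a\<close> and \<open>b\<close> come in unknown order.
  The radial function is therefore \<open>max a b\<close>, and it is attained.\<close>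

lemma star_set_radial_function:
  assumes "star_set L" "norm t = 1"
  shows "0 \<le> radial_function L t" and "0 \<le> c \<Longrightarrow> c *\<^sub>R t \<in> L \<longleftrightarrow> c \<le> radial_function L t"
proof -
  have "t \<noteq> 0" using assms by auto
  have "0 \<in> L \<inter> span {t}" using assms by (auto simp: star_set_def span_zero)
  then obtain p q where pq: "L \<inter> span {t} = closed_segment p q"
    using assms \<open>t \<noteq> 0\<close> unfolding star_set_def by blast
  then have "p \<in> span {t}" "q \<in> span {t}" by auto
  then obtain a b where ab: "p = a *\<^sub>R t" "q = b *\<^sub>R t" by (auto simp: span_singleton)
  have in_L: "c *\<^sub>R t \<in> L \<longleftrightarrow> c \<in> closed_segment a b" for c
  proof -
    have "c *\<^sub>R t \<in> L \<longleftrightarrow> c *\<^sub>R t \<in> L \<inter> span {t}" by (auto simp: span_singleton)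
    also have "\<dots> \<longleftrightarrow> c \<in> closed_segment a b"
      using \<open>t \<noteq> 0\<close> by (auto simp: pq ab closed_segment_scaleR)
    finally show ?thesis .
  qed
  have "0 \<in> closed_segment a b" using in_L[of 0] assms by (simp add: star_set_def)
  then have "{c. 0 \<le> c \<and> c *\<^sub>R t \<in> L} = {0..max a b}" "0 \<le> max a b"
    unfolding in_L by (auto simp: closed_segment_eq_real_ivl split: if_splits)
  then have max: "radial_function L t = max a b" "0 \<le> max a b"
    by (auto simp: radial_function_def)
  then show "0 \<le> radial_function L t" by simp
  show "c *\<^sub>R t \<in> L \<longleftrightarrow> c \<le> radial_function L t" if "0 \<le> c"
    using \<open>0 \<in> closed_segment a b\<close> that unfolding in_L max
    by (auto simp: closed_segment_eq_real_ivl split: if_splits)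
qed

lemma radial_function_nonneg_continuous:
  "L \<in> star_bodies \<Longrightarrow> radial_function L \<in> nonneg_continuous (sphere 0 1)"
  by (auto simp: star_bodies_def nonneg_continuous_def star_set_radial_function)

lemma star_body_of_radial_function:
  fixes L :: "(real ^ 'n) set"
  assumes "L \<in> star_bodies"
  shows "star_body_of (radial_function L) = L"
proof (rule set_eqI)
  fix x :: "real ^ 'n"
  obtain c t where "norm t = 1" "0 \<le> c" "x = c *\<^sub>R t" by (rule eq_scaleR_sphere)
  moreover have "star_set L" using assms by (simp add: star_bodies_def)
  ultimately show "x \<in> star_body_of (radial_function L) \<longleftrightarrow> x \<in> L"
    by (simp add: scaleR_in_star_body_of_iff radial_function_nonneg_continuous assms star_set_radial_function)
qed

lemma radial_function_star_body_of:
  assumes "f \<in> nonneg_continuous (sphere 0 1)" "norm t = 1"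
  shows "radial_function (star_body_of f) t = f t"
proof -
  have "{c. 0 \<le> c \<and> c *\<^sub>R t \<in> star_body_of f} = {0..f t}"
    using scaleR_in_star_body_of_iff[OF assms] by auto
  moreover have "0 \<le> f t" using assms by (auto simp: nonneg_continuous_def)
  ultimately show ?thesis by (simp add: radial_function_def)
qed

lemma star_body_of_in_star_bodies:
  assumes f: "f \<in> nonneg_continuous (sphere 0 1)"
  shows "star_body_of f \<in> star_bodies"
proof -
  have "\<exists>a b. star_body_of f \<inter> span {u} = closed_segment a b" if "u \<noteq> 0" for u
  proof -
    define t where "t = u /\<^sub>R norm u"
    have t: "norm t = 1" using that by (simp add: t_def)
    have span: "span {u} = range (\<lambda>c. c *\<^sub>R t)"
    proof -
      have "c *\<^sub>R u = (c * norm u) *\<^sub>R t" "c *\<^sub>R t = (c / norm u) *\<^sub>R u" for c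
        using that by (simp_all add: t_def divide_inverse)
      then have "range (\<lambda>c. c *\<^sub>R u) \<subseteq> range (\<lambda>c. c *\<^sub>R t)" "range (\<lambda>c. c *\<^sub>R t) \<subseteq> range (\<lambda>c. c *\<^sub>R u)"
        by (metis image_subsetI rangeI)+
      then show ?thesis unfolding span_singleton by (rule equalityI)
    qed
    have pos: "0 \<le> f t" "0 \<le> f (- t)" using f t by (auto simp: nonneg_continuous_def)
    \<comment> \<open>The line consists of two rays: a negative \<open>c\<close> is the coordinate
      \<open>- c\<close> along \<open>- t\<close>, so the segment ends at
      \<open>- f (- t)\<close>.\<close>
    have iff: "c *\<^sub>R t \<in> star_body_of f \<longleftrightarrow> - f (- t) \<le> c \<and> c \<le> f t" for c
    proof (cases "0 \<le> c")
      case True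
      then show ?thesis using scaleR_in_star_body_of_iff[OF f t] pos by auto
    next
      case False
      then show ?thesis using scaleR_in_star_body_of_iff[OF f, of "- t" "- c"] t pos by auto
    qed
    have "star_body_of f \<inter> span {u} = (\<lambda>c. c *\<^sub>R t) ` {c. c *\<^sub>R t \<in> star_body_of f}"
      unfolding span by blast
    also have "\<dots> = (\<lambda>c. c *\<^sub>R t) ` {- f (- t)..f t}"
      unfolding iff atLeastAtMost_def atLeast_def atMost_def by (simp only: Collect_conj_eq)
    also have "\<dots> = closed_segment ((- f (- t)) *\<^sub>R t) (f t *\<^sub>R t)"
      using pos by (simp only: closed_segment_scaleR) (simp add: closed_segment_eq_real_ivl)
    finally show ?thesis by blast
  qed
  then have "star_set (star_body_of f)" by (auto simp: star_set_def star_body_of_def)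
  moreover have "continuous_on (sphere 0 1) (radial_function (star_body_of f)) \<longleftrightarrow>
      continuous_on (sphere 0 1) f"
    by (intro continuous_on_cong radial_function_star_body_of f) auto
  ultimately show ?thesis using f by (auto simp: star_bodies_def nonneg_continuous_def)
qed

lemma star_body_of_max: "star_body_of (\<lambda>t. max (f t) (g t)) = star_body_of f \<union> star_body_of g"
  by (auto simp: star_body_of_def le_max_iff_disj)

lemma star_body_of_min: "star_body_of (\<lambda>t. min (f t) (g t)) = star_body_of f \<inter> star_body_of g"
  by (auto simp: star_body_of_def)

lemma star_body_of_zero: "star_body_of (\<lambda>_. 0) = {0}"
  by (auto simp: star_body_of_def)

text \<open>The transpose is the inverse of \<open>Q\<close>, preserves norms and is linear, so it
  maps the direction of \<open>x\<close> to the direction of its image.\<close>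

lemma orthogonal_image_star_body_of:
  assumes "orthogonal_matrix (Q :: real ^ 'n ^ 'n)"
  shows "(\<lambda>x. Q *v x) ` star_body_of f = star_body_of (\<lambda>t. f (transpose Q *v t))"
proof -
  have Q: "transpose Q *v (Q *v x) = x" "Q *v (transpose Q *v x) = x" for x
    using assms by (simp_all add: orthogonal_matrix_def matrix_vector_mul_assoc del: transpose_matrix_vector)
  have norm: "norm (transpose Q *v x) = norm x" for x
    using assms orthogonal_transformation_norm[of "(*v) (transpose Q)"]
    by (simp add: orthogonal_transformation_matrix orthogonal_matrix_transpose)
  have "x \<in> (\<lambda>x. Q *v x) ` star_body_of f \<longleftrightarrow> transpose Q *v x \<in> star_body_of f" for x
    unfolding image_iff using Q by metis
  also have "transpose Q *v x \<in> star_body_of f \<longleftrightarrow> x \<in> star_body_of (\<lambda>t. f (transpose Q *v t))" for x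
    using norm[of x] Q[of x]
    by (auto simp: star_body_of_def matrix_vector_mult_scaleR simp del: transpose_matrix_vector)
  finally show ?thesis by blast
qed

section \<open>The radial metric and the passage between bodies and functions\<close>

text \<open>Continuity on the compact sphere bounds the differences, so the supremum dominates each
  of them.\<close>

lemma sup_dist_less_if_radial_dist_less:
  assumes "K \<in> star_bodies" "L \<in> star_bodies" "radial_dist K L < d" "norm t = 1"
  shows "\<bar>radial_function K t - radial_function L t\<bar> < d"
proof -
  have "continuous_on (sphere 0 1) (\<lambda>t. \<bar>radial_function K t - radial_function L t\<bar>)"
    using assms by (auto simp: star_bodies_def intro!: continuous_intros)
  then have "bdd_above ((\<lambda>t. \<bar>radial_function K t - radial_function L t\<bar>) ` sphere 0 1)"
    by (intro bounded_imp_bdd_above compact_imp_bounded compact_continuous_image) auto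
  then have "\<bar>radial_function K t - radial_function L t\<bar> \<le> radial_dist K L"
    unfolding radial_dist_def using assms(4) by (intro cSUP_upper) auto
  with assms(3) show ?thesis by simp
qed

lemma radial_dist_le:
  fixes K :: "(real ^ 'n) set"
  assumes "\<And>t. norm t = 1 \<Longrightarrow> \<bar>radial_function K t - radial_function L t\<bar> \<le> d"
  shows "radial_dist K L \<le> d"
proof -
  have "sphere 0 1 \<noteq> ({} :: (real ^ 'n) set)" by simp
  then show ?thesis unfolding radial_dist_def using assms by (intro cSUP_least) auto
qed

lemma continuous_valuation_star_body_of:
  fixes V :: "(real ^ 'n) set \<Rightarrow> real"
  assumes "radial_continuous V" "valuation V" "V {0} = 0"
  shows "continuous_valuation (sphere 0 1) (\<lambda>f. V (star_body_of f))"
proof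
  fix f :: "real ^ 'n \<Rightarrow> real" and e :: real
  assume f: "f \<in> nonneg_continuous (sphere 0 1)" and "0 < e"
  then obtain d where d: "d > 0" "\<And>L. L \<in> star_bodies \<Longrightarrow> radial_dist (star_body_of f) L < d \<Longrightarrow>
      \<bar>V L - V (star_body_of f)\<bar> < e"
    using assms(1) star_body_of_in_star_bodies[OF f] unfolding radial_continuous_def by meson
  have "\<bar>V (star_body_of g) - V (star_body_of f)\<bar> < e"
    if g: "g \<in> nonneg_continuous (sphere 0 1)" and close: "\<forall>x\<in>sphere 0 1. \<bar>g x - f x\<bar> < d / 2" for g
  proof (rule d(2)[OF star_body_of_in_star_bodies[OF g]])
    \<comment> \<open>Strict pointwise bounds give only a weak bound on the supremum; halving
      \<open>d\<close> restores strictness.\<close>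
    have "radial_dist (star_body_of f) (star_body_of g) \<le> d / 2"
    proof (rule radial_dist_le)
      fix t :: "real ^ 'n" assume "norm t = 1"
      with close have "\<bar>g t - f t\<bar> < d / 2" by simp
      then show "\<bar>radial_function (star_body_of f) t - radial_function (star_body_of g) t\<bar> \<le> d / 2"
        using \<open>norm t = 1\<close> by (simp add: radial_function_star_body_of f g abs_minus_commute)
    qed
    then show "radial_dist (star_body_of f) (star_body_of g) < d" using d(1) by simp
  qed
  then show "\<exists>d>0. \<forall>g\<in>nonneg_continuous (sphere 0 1). (\<forall>x\<in>sphere 0 1. \<bar>g x - f x\<bar> < d) \<longrightarrow>
      \<bar>V (star_body_of g) - V (star_body_of f)\<bar> < e"
    using d(1) by (intro exI[of _ "d / 2"]) auto
next
  fix f g :: "real ^ 'n \<Rightarrow> real"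
  assume "f \<in> nonneg_continuous (sphere 0 1)" "g \<in> nonneg_continuous (sphere 0 1)"
  then show "V (star_body_of (\<lambda>x. max (f x) (g x))) + V (star_body_of (\<lambda>x. min (f x) (g x)))
      = V (star_body_of f) + V (star_body_of g)"
    using assms(2) star_body_of_in_star_bodies unfolding valuation_def star_body_of_max star_body_of_min
    by blast
qed (simp_all add: assms star_body_of_zero)

text \<open>Both bodies are recovered from their radial functions, so union and intersection are the
  bodies of the pointwise maximum and minimum.\<close>

lemma radial_function_Un_Int:
  assumes K: "K \<in> star_bodies" and L: "L \<in> star_bodies" and t: "norm t = 1"
  shows "radial_function (K \<union> L) t = max (radial_function K t) (radial_function L t)"
    and "radial_function (K \<inter> L) t = min (radial_function K t) (radial_function L t)"
proof -
  let ?k = "radial_function K" and ?l = "radial_function L"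
  have eq: "star_body_of ?k = K" "star_body_of ?l = L"
    using K L by (auto simp: star_body_of_radial_function)
  note C = K[THEN radial_function_nonneg_continuous] L[THEN radial_function_nonneg_continuous]
  show "radial_function (K \<union> L) t = max (?k t) (?l t)"
    using radial_function_star_body_of[OF nonneg_continuous_intros(2)[OF C] t]
    by (simp add: star_body_of_max eq)
  show "radial_function (K \<inter> L) t = min (?k t) (?l t)"
    using radial_function_star_body_of[OF nonneg_continuous_intros(3)[OF C] t]
    by (simp add: star_body_of_min eq)
qed

section \<open>The decomposition\<close>

text \<open>On a star body \<open>L\<close> this is the supremum of \<open>V\<close> over the star
  bodies contained in \<open>L\<close>.\<close>

definition positive_variation :: "((real ^ 'n) set \<Rightarrow> real) \<Rightarrow> (real ^ 'n) set \<Rightarrow> real" where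
  "positive_variation V L = positive_part (sphere 0 1) (\<lambda>f. V (star_body_of f)) (radial_function L)"

text \<open>Rotating \<open>L\<close> by \<open>Q\<close> composes its radial function with the
  transpose of \<open>Q\<close>, and the hull is unchanged under such a composition because
  \<open>V\<close> is invariant under \<open>Q\<close> and its inverse.\<close>

lemma rotation_invariant_positive_variation:
  fixes V :: "(real ^ 'n) set \<Rightarrow> real"
  assumes "rotation_invariant V"
  shows "rotation_invariant (positive_variation V)"
  unfolding rotation_invariant_def
proof (intro allI impI ballI)
  fix Q :: "real ^ 'n ^ 'n" and L :: "(real ^ 'n) set"
  assume rot: "rotation_matrix Q" and L: "L \<in> star_bodies"
  let ?T = "\<lambda>x. transpose Q *v x" and ?l = "radial_function L"
  let ?W = "\<lambda>f. V (star_body_of f)"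
  have orth: "orthogonal_matrix Q" "orthogonal_matrix (transpose Q)"
    using rot by (auto simp: rotation_matrix_def orthogonal_matrix_transpose)
  have rot': "rotation_matrix (transpose Q)"
    using rot orth by (simp add: rotation_matrix_def det_transpose)
  have inverse: "transpose Q *v (Q *v x) = x" "Q *v (transpose Q *v x) = x" for x
    using orth by (simp_all add: orthogonal_matrix_def matrix_vector_mul_assoc del: transpose_matrix_vector)
  have norm: "norm (A *v x) = norm x" if "orthogonal_matrix A" for A :: "real ^ 'n ^ 'n" and x
    using that orthogonal_transformation_norm[of "(*v) A"] by (simp add: orthogonal_transformation_matrix)
  have cont: "continuous_on (sphere 0 1) (\<lambda>x. A *v x)" for A :: "real ^ 'n ^ 'n"
    by (intro linear_continuous_on matrix_vector_mul_bounded_linear)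
  have W: "?W (\<lambda>x. g (?T x)) = ?W g" "?W (\<lambda>x. g (Q *v x)) = ?W g"
    if "g \<in> nonneg_continuous (sphere 0 1)" for g
  proof -
    note inv = assms[unfolded rotation_invariant_def, rule_format, OF _ star_body_of_in_star_bodies[OF that]]
    show "?W (\<lambda>x. g (?T x)) = ?W g"
      using inv[OF rot] by (simp only: orthogonal_image_star_body_of[OF orth(1)])
    show "?W (\<lambda>x. g (Q *v x)) = ?W g"
      using inv[OF rot'] by (simp only: orthogonal_image_star_body_of[OF orth(2)] transpose_transpose)
  qed
  have "radial_function ((\<lambda>x. Q *v x) ` L) t = ?l (?T t)" if "norm t = 1" for t
  proof -
    have "continuous_on (sphere 0 1) (\<lambda>t. ?l (?T t))"
      using L norm[OF orth(2)] by (intro continuous_on_compose2[OF _ cont[of "transpose Q"], of "sphere 0 1"])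
        (auto simp: star_bodies_def)
    then have "(\<lambda>t. ?l (?T t)) \<in> nonneg_continuous (sphere 0 1)"
      using L norm[OF orth(2)] by (auto simp: nonneg_continuous_def star_bodies_def star_set_radial_function(1))
    from radial_function_star_body_of[OF this that] show ?thesis
      using orthogonal_image_star_body_of[OF orth(1), of ?l] by (simp add: star_body_of_radial_function L)
  qed
  then have "positive_variation V ((\<lambda>x. Q *v x) ` L) = positive_part (sphere 0 1) ?W (\<lambda>x. ?l (?T x))"
    unfolding positive_variation_def by (intro positive_part_cong) auto
  also have "\<dots> = positive_variation V L"
    unfolding positive_variation_def
    by (rule positive_part_compose[where T' = "\<lambda>x. Q *v x"]) 
      (auto simp: cont norm orth inverse W simp del: transpose_matrix_vector)
  finally show "positive_variation V ((\<lambda>x. Q *v x) ` L) = positive_variation V L" .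
qed

theorem theorem1p3:
  fixes V :: "(real ^ 'n) set \<Rightarrow> real"
  assumes "radial_continuous V"
    and "valuation V"
    and "V {0} = 0"
  shows "\<exists>Vp Vm :: (real ^ 'n) set \<Rightarrow> real.
           radial_continuous Vp \<and> valuation Vp \<and>
           radial_continuous Vm \<and> valuation Vm \<and>
           (\<forall>L\<in>star_bodies. 0 \<le> Vp L) \<and> (\<forall>L\<in>star_bodies. 0 \<le> Vm L) \<and>
           Vp {0} = 0 \<and> Vm {0} = 0 \<and>
           (\<forall>L\<in>star_bodies. V L = Vp L - Vm L) \<and>
           (rotation_invariant V \<longrightarrow> rotation_invariant Vp \<and> rotation_invariant Vm)"
proof -
  let ?W = "\<lambda>f. V (star_body_of f)"
  interpret W: continuous_valuation "sphere 0 1" ?W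
    using assms by (rule continuous_valuation_star_body_of)
  \<comment> \<open>The negative part is the excess of the hull over \<open>V\<close>; continuity,
    modularity and invariance pass to the difference.\<close>
  let ?P = "positive_variation V" and ?M = "\<lambda>L. positive_variation V L - V L"
  note C = radial_function_nonneg_continuous
  have P_cont: "radial_continuous ?P"
    unfolding radial_continuous_def
  proof (intro ballI allI impI)
    fix K :: "(real ^ 'n) set" and e :: real assume K: "K \<in> star_bodies" and "0 < e"
    obtain d where "d > 0" and d: "\<And>g. g \<in> nonneg_continuous (sphere 0 1) \<Longrightarrow>
        (\<forall>x\<in>sphere 0 1. \<bar>g x - radial_function K x\<bar> < d) \<Longrightarrow>
        \<bar>positive_part (sphere 0 1) ?W g - ?P K\<bar> < e"
      using W.positive_part_continuous[OF C[OF K] \<open>0 < e\<close>] by (auto simp: positive_variation_def)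
    have "\<bar>?P L - ?P K\<bar> < e" if "L \<in> star_bodies" "radial_dist K L < d" for L
      using d[OF C[OF that(1)]] sup_dist_less_if_radial_dist_less[OF K that]
      by (simp add: positive_variation_def abs_minus_commute)
    with \<open>d > 0\<close> show "\<exists>d>0. \<forall>L\<in>star_bodies. radial_dist K L < d \<longrightarrow> \<bar>?P L - ?P K\<bar> < e" by blast
  qed
  have P_val: "valuation ?P"
    unfolding valuation_def
  proof (intro ballI)
    fix K L :: "(real ^ 'n) set" assume KL: "K \<in> star_bodies" "L \<in> star_bodies"
    let ?k = "radial_function K" and ?l = "radial_function L"
    have "?P (K \<union> L) = positive_part (sphere 0 1) ?W (\<lambda>t. max (?k t) (?l t))"
      "?P (K \<inter> L) = positive_part (sphere 0 1) ?W (\<lambda>t. min (?k t) (?l t))"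
      unfolding positive_variation_def using KL by (auto intro!: positive_part_cong radial_function_Un_Int)
    then show "?P (K \<union> L) + ?P (K \<inter> L) = ?P K + ?P L"
      using W.positive_part_modular[OF KL[THEN C]] by (simp add: positive_variation_def)
  qed
  have M_cont: "radial_continuous ?M"
    unfolding radial_continuous_def
  proof (intro ballI allI impI)
    fix K :: "(real ^ 'n) set" and e :: real assume K: "K \<in> star_bodies" and "0 < e"
    then have "0 < e / 2" by simp
    obtain d1 where d1: "d1 > 0" "\<And>L. L \<in> star_bodies \<Longrightarrow> radial_dist K L < d1 \<Longrightarrow> \<bar>?P L - ?P K\<bar> < e / 2"
      using P_cont K \<open>0 < e / 2\<close> unfolding radial_continuous_def by meson
    obtain d2 where d2: "d2 > 0" "\<And>L. L \<in> star_bodies \<Longrightarrow> radial_dist K L < d2 \<Longrightarrow> \<bar>V L - V K\<bar> < e / 2"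
      using assms(1) K \<open>0 < e / 2\<close> unfolding radial_continuous_def by meson
    have "\<bar>?M L - ?M K\<bar> < e" if "L \<in> star_bodies" "radial_dist K L < min d1 d2" for L
      using d1(2)[of L] d2(2)[of L] that by linarith
    then show "\<exists>d>0. \<forall>L\<in>star_bodies. radial_dist K L < d \<longrightarrow> \<bar>?M L - ?M K\<bar> < e"
      using d1(1) d2(1) by (intro exI[of _ "min d1 d2"]) auto
  qed
  have M_val: "valuation ?M"
    unfolding valuation_def
  proof (intro ballI)
    fix K L :: "(real ^ 'n) set" assume "K \<in> star_bodies" "L \<in> star_bodies"
    then have "?P (K \<union> L) + ?P (K \<inter> L) = ?P K + ?P L" "V (K \<union> L) + V (K \<inter> L) = V K + V L"
      using P_val assms(2) by (auto simp: valuation_def)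
    then show "?M (K \<union> L) + ?M (K \<inter> L) = ?M K + ?M L" by linarith
  qed
  \<comment> \<open>\<open>L\<close> competes in its own supremum, so \<open>V L\<close> is at most
    its positive variation.\<close>
  have P_nonneg: "0 \<le> ?P L" and M_nonneg: "0 \<le> ?M L" if "L \<in> star_bodies" for L
    using W.positive_part_nonneg[OF C[OF that]] W.positive_part_upper[OF C[OF that] C[OF that]]
    by (auto simp: positive_variation_def star_body_of_radial_function that)
  have "radial_function {0} t = 0" if "norm t = 1" for t :: "real ^ 'n"
    using radial_function_star_body_of[OF nonneg_continuous_intros(1)[of 0] that] by (simp add: star_body_of_zero)
  then have "?P {0} = positive_part (sphere 0 1) ?W (\<lambda>_. 0)"
    unfolding positive_variation_def by (intro positive_part_cong) auto
  then have P_zero: "?P {0} = 0" by (simp add: W.positive_part_zero)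
  have rot: "rotation_invariant ?P \<and> rotation_invariant ?M" if "rotation_invariant V"
    using rotation_invariant_positive_variation[OF that] that by (auto simp: rotation_invariant_def)
  show ?thesis
    using P_cont P_val M_cont M_val P_nonneg M_nonneg P_zero rot assms(3)
    by (intro exI[of _ ?P] exI[of _ ?M]) auto
qed

end
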